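(* Let $n\geq 3$ be an integer and let $K_{1,n-1}$ be the star graph on $n$ vertices. Then, for every $\gamma_R$-function $f$ of $K_{1,n-1}$, the minimum roman dominating distance energy of $K_{1,n-1}$ (computed from $f$) is $E_{RDd}(K_{1,n-1})=4n-6$.
   Context: Graphs are finite and simple. A Roman dominating function (RDF) on a connected graph $G=(V,E)$ is a function $f:V\to\{0,1,2\}$ such that every vertex $u$ with $f(u)=0$ is adjacent to at least one vertex $v$ with $f(v)=2$. Its weight is $\sum_{v\in V}f(v)$; $\gamma_R(G)$ is the minimum weight of an RDF of $G$, and an RDF of weight $\gamma_R(G)$ is called a $\gamma_R$-function. Write $V_i=\{v\in V: f(v)=i\}$. Let $V=\{v_1,\dots,v_n\}$ and let $f$ be a $\gamma_R$-function of $G$. The minimum roman dominating distance matrix $A_{RDd}(G)=(\bar d_{ij})$ is the real symmetric $n\times n$ matrix with $\bar d_{ii}=2$ if $v_i\in V_2$, $\bar d_{ii}=1$ if $v_i\in V_1$, $\bar d_{ii}=0$ if $v_i\in V_0$, and $\bar d_{ij}=d(v_i,v_j)$ (graph distance) for $i\ne j$. The minimum roman dominating distance energy is $E_{RDd}(G)=\sum_{k=1}^n|\rho_k|$, where $\rho_1,\dots,\rho_n$ are the eigenvalues of $A_{RDd}(G)$ with multiplicity. *)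

theory Defs
  imports
    "Graph_Theory.Kuratowski"
    "Graph_Theory.Shortest_Path"
    "Jordan_Normal_Form.Char_Poly"
    "Jordan_Normal_Form.Spectral_Radius"
begin

text \<open>Finite simple graphs are the library's loop-free symmetric digraphs without parallel arcs
  (locale \<^locale>\<open>graph\<close>). Values of \<open>f\<close> outside the vertex set are irrelevant.\<close>

definition roman_dominating :: "('a, 'b) pre_digraph \<Rightarrow> ('a \<Rightarrow> nat) \<Rightarrow> bool" where
  "roman_dominating G f \<longleftrightarrow>
     f \<in> verts G \<rightarrow> {0, 1, 2} \<and>
     (\<forall>u\<in>verts G. f u = 0 \<longrightarrow> (\<exists>v\<in>verts G. u \<rightarrow>\<^bsub>G\<^esub> v \<and> f v = 2))"

definition roman_weight :: "('a, 'b) pre_digraph \<Rightarrow> ('a \<Rightarrow> nat) \<Rightarrow> nat" where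
  "roman_weight G f = (\<Sum>v\<in>verts G. f v)"

definition roman_domination_number :: "('a, 'b) pre_digraph \<Rightarrow> nat" where
  "roman_domination_number G = (LEAST w. \<exists>f. roman_dominating G f \<and> roman_weight G f = w)"

definition gamma_R_function :: "('a, 'b) pre_digraph \<Rightarrow> ('a \<Rightarrow> nat) \<Rightarrow> bool" where
  "gamma_R_function G f \<longleftrightarrow>
     roman_dominating G f \<and> roman_weight G f = roman_domination_number G"

definition level_set :: "('a, 'b) pre_digraph \<Rightarrow> ('a \<Rightarrow> nat) \<Rightarrow> nat \<Rightarrow> 'a set" where
  "level_set G f i = {v \<in> verts G. f v = i}"

text \<open>The distance is the least length of a walk. The value of \<^const>\<open>real_of_ereal\<close> at infinity,
  which is 0, only concerns vertices in different components.\<close>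

definition graph_dist :: "('a, 'b) pre_digraph \<Rightarrow> 'a \<Rightarrow> 'a \<Rightarrow> real" where
  "graph_dist G u v = real_of_ereal (wf_digraph.\<mu> G (\<lambda>_. 1) u v)"

text \<open>The list \<open>vs\<close> is the enumeration of the vertices that indexes rows and columns.\<close>

definition roman_distance_matrix ::
  "('a, 'b) pre_digraph \<Rightarrow> ('a \<Rightarrow> nat) \<Rightarrow> 'a list \<Rightarrow> real mat" where
  "roman_distance_matrix G f vs = mat (length vs) (length vs) (\<lambda>(i, j).
     if i = j then
       (if vs ! i \<in> level_set G f 2 then 2 else if vs ! i \<in> level_set G f 1 then 1 else 0)
     else graph_dist G (vs ! i) (vs ! j))"

text \<open>The multiplicity of an eigenvalue is its order as a root of the characteristic polynomial.
  The matrix is real symmetric when \<open>G\<close> is a graph, so its eigenvalues are all real and the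
  multiplicities over the real spectrum add up to the number of vertices.\<close>

definition roman_distance_energy ::
  "('a, 'b) pre_digraph \<Rightarrow> ('a \<Rightarrow> nat) \<Rightarrow> 'a list \<Rightarrow> real" where
  "roman_distance_energy G f vs =
     (let A = roman_distance_matrix G f vs
      in \<Sum>\<rho>\<in>spectrum A. real (order \<rho> (char_poly A)) * \<bar>\<rho>\<bar>)"

end

theory Submission
  imports Defs
begin

text \<open>A minimum Roman dominating function of a star with at least two leaves must put 2 on the centre
  and 0 on the leaves. After adding \<open>2I\<close>, the distance matrix has rank 2: it factors as \<open>U V\<close> through
  a two-dimensional space. Sylvester's identity relating \<open>det (y I - U V)\<close> and \<open>det (y I - V U)\<close> then
  gives the characteristic polynomial \<open>(x + 2)^(n - 2) (x^2 - (2 n - 2) x + (3 n - 7))\<close>, whose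
  quadratic factor has two positive roots with sum \<open>2 n - 2\<close>.\<close>

text \<open>The block matrix \<open>M\<close> is made triangular in two ways: multiplying by
  \<open>L\<close> from the left clears its upper right block, multiplying by \<open>R\<close>
  clears its lower left block. Comparing the two values of \<open>det M\<close> gives the identity;
  keeping the powers of \<open>y\<close> avoids division, so \<open>y\<close> may be a
  polynomial.\<close>

lemma sylvester_determinant:
  fixes U V :: "'a :: idom mat"
  assumes U: "U \<in> carrier_mat n m" and V: "V \<in> carrier_mat m n"
  shows "y ^ m * det (y \<cdot>\<^sub>m 1\<^sub>m n - U * V) = y ^ n * det (y \<cdot>\<^sub>m 1\<^sub>m m - V * U)"
proof -
  define M where "M = four_block_mat (y \<cdot>\<^sub>m 1\<^sub>m n) U V (1\<^sub>m m)"
  define L where "L = four_block_mat (1\<^sub>m n) (- U) (0\<^sub>m m n) (1\<^sub>m m)"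
  define R where "R = four_block_mat (1\<^sub>m n) (0\<^sub>m n m) (- V) (y \<cdot>\<^sub>m 1\<^sub>m m)"
  have carr: "M \<in> carrier_mat (n + m) (n + m)" "L \<in> carrier_mat (n + m) (n + m)"
    "R \<in> carrier_mat (n + m) (n + m)"
    using U V by (auto simp: M_def L_def R_def)
  have detL: "det L = 1"
    unfolding L_def using U by (subst det_four_block_mat_lower_left_zero[of _ n _ m]) auto
  have detR: "det R = y ^ m"
    unfolding R_def using V by (subst det_four_block_mat_upper_right_zero[of _ n _ m]) auto
  have "L * M = four_block_mat (y \<cdot>\<^sub>m 1\<^sub>m n - U * V) (0\<^sub>m n m) V (1\<^sub>m m)"
    unfolding L_def M_def using U V
    by (subst mult_four_block_mat[of _ n n _ m _ m _ _ n _ m])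
       (auto intro!: cong_four_block_mat simp: minus_add_uminus_mat[of _ n n])
  hence "det (L * M) = det (y \<cdot>\<^sub>m 1\<^sub>m n - U * V)"
    using U V by (simp add: det_four_block_mat_upper_right_zero[of _ n _ m] minus_carrier_mat
      mult_carrier_mat[of _ n m])
  hence 1: "det M = det (y \<cdot>\<^sub>m 1\<^sub>m n - U * V)"
    using det_mult[OF carr(2,1)] detL by simp
  have "R * M = four_block_mat (y \<cdot>\<^sub>m 1\<^sub>m n) U (0\<^sub>m m n) (y \<cdot>\<^sub>m 1\<^sub>m m - V * U)"
    unfolding R_def M_def using U V
    by (subst mult_four_block_mat[of _ n n _ m _ m _ _ n _ m])
       (auto intro!: cong_four_block_mat eq_matI)
  hence "det (R * M) = y ^ n * det (y \<cdot>\<^sub>m 1\<^sub>m m - V * U)"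
    using U V by (simp add: det_four_block_mat_lower_left_zero[of _ n _ m] minus_carrier_mat
      mult_carrier_mat[of _ m n])
  thus ?thesis
    using det_mult[OF carr(3,1)] detR 1 by simp
qed

lemma det_mat_2:
  fixes A :: "'a :: comm_ring_1 mat"
  assumes "A \<in> carrier_mat 2 2"
  shows "det A = A $$ (0, 0) * A $$ (1, 1) - A $$ (0, 1) * A $$ (1, 0)"
  using assms by (simp add: laplace_expansion_row[of A 2 0] cofactor_def mat_delete_def
      numeral_2_eq_2 det_single)

text \<open>The target form of the matrix of the star; \<open>k\<close> is the position of the
  centre in the enumeration.\<close>

definition star_matrix :: "nat \<Rightarrow> nat \<Rightarrow> real mat" where
  "star_matrix n k = mat n n (\<lambda>(i, j).
     if i = j then (if i = k then 2 else 0) else if i = k \<or> j = k then 1 else 2)"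

lemma char_poly_star_matrix:
  assumes k: "k < n" and n: "2 \<le> n"
  shows "char_poly (star_matrix n k) = [:2, 1:] ^ (n - 2) * [:3 * real n - 7, - (2 * real n - 2), 1:]"
proof -
  \<comment> \<open>With \<open>y\<close> = x + 2, the matrix xI - A becomes yI - (A + 2I), and A +
    2I has only two distinct rows.\<close>
  define y :: "real poly" where "y = [:2, 1:]"
  \<comment> \<open>The columns of \<open>U\<close> are the indicators of the centre and of the
    leaves; the rows of \<open>V\<close> are the centre row and the common leaf row of A +
    2I.\<close>
  define U :: "real poly mat" where
    "U = mat n 2 (\<lambda>(i, a). if (i = k) = (a = 0) then 1 else 0)"
  define V :: "real poly mat" where
    "V = mat 2 n (\<lambda>(a, i). if a = 0 then (if i = k then 4 else 1) else (if i = k then 1 else 2))"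
  have UV: "U \<in> carrier_mat n 2" "V \<in> carrier_mat 2 n" by (auto simp: U_def V_def)
  have upd: "(\<Sum>i = 0..<n. if i = k then 0 else (c :: real poly)) = of_nat (n - 1) * c" for c
  proof -
    have "(\<Sum>i = 0..<n. if i = k then 0 else c) = (\<Sum>i \<in> {0..<n} - {k}. c)"
      by (rule sum.mono_neutral_cong_right) auto
    thus ?thesis using k by simp
  qed
  have "char_poly_matrix (star_matrix n k) = y \<cdot>\<^sub>m 1\<^sub>m n - U * V"
    by (rule eq_matI)
       (auto simp: char_poly_matrix_def star_matrix_def y_def U_def V_def scalar_prod_def
         numeral_2_eq_2 numeral_poly)
  hence "y ^ 2 * char_poly (star_matrix n k) = y ^ n * det (y \<cdot>\<^sub>m 1\<^sub>m 2 - V * U)"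
    using sylvester_determinant[OF UV, of y] by (simp add: char_poly_def)
  \<comment> \<open>\<open>V * U\<close> is the quotient matrix of A + 2I for the partition into
    centre and leaves, with rows (4, n - 1) and (1, 2(n - 1)).\<close>
  also have "det (y \<cdot>\<^sub>m 1\<^sub>m 2 - V * U) = (y - 4) * (y - of_nat (n - 1) * 2) - of_nat (n - 1)"
  proof -
    have "(V * U) $$ (0, 0) = (\<Sum>i = 0..<n. if i = k then 4 else 0)"
      "(V * U) $$ (0, 1) = (\<Sum>i = 0..<n. if i = k then 0 else 1)"
      "(V * U) $$ (1, 0) = (\<Sum>i = 0..<n. if i = k then 1 else 0)"
      "(V * U) $$ (1, 1) = (\<Sum>i = 0..<n. if i = k then 0 else 2)"
      by (auto simp: U_def V_def scalar_prod_def simp del: sum.delta sum.delta'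
          intro!: sum.cong)
    hence "(V * U) $$ (0, 0) = 4" "(V * U) $$ (0, 1) = of_nat (n - 1)"
      "(V * U) $$ (1, 0) = 1" "(V * U) $$ (1, 1) = of_nat (n - 1) * 2"
      using k by (simp_all add: upd)
    moreover have "y \<cdot>\<^sub>m 1\<^sub>m 2 - V * U \<in> carrier_mat 2 2" using UV by (simp add: minus_carrier_mat)
    ultimately show ?thesis using UV by (simp add: det_mat_2)
  qed
  also have "\<dots> = [:3 * real n - 7, - (2 * real n - 2), 1:]"
    using n by (simp add: y_def numeral_poly of_nat_poly of_nat_diff algebra_simps)
  also have "y ^ n = y ^ 2 * y ^ (n - 2)"
    using n by (metis le_add_diff_inverse power_add)
  finally have "y ^ 2 * char_poly (star_matrix n k)
      = y ^ 2 * (y ^ (n - 2) * [:3 * real n - 7, - (2 * real n - 2), 1:])"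
    by (simp only: mult.assoc)
  moreover have "y ^ 2 \<noteq> 0" by (simp add: y_def)
  ultimately show ?thesis unfolding y_def using mult_left_cancel by blast
qed

text \<open>The eigenvalue -2 contributes 2(n - 2). The other two are positive, so their absolute
  values add up to 2n - 2, read off the linear coefficient.\<close>

lemma sum_spectrum_star_matrix:
  assumes k: "k < n" and n: "3 \<le> n"
  shows "(\<Sum>\<rho>\<in>spectrum (star_matrix n k). real (order \<rho> (char_poly (star_matrix n k))) * \<bar>\<rho>\<bar>)
    = 4 * real n - 6"
proof -
  \<comment> \<open>The radicand is a quarter of the discriminant: (n - 1)^2 - (3n - 7).\<close>
  define s where "s = sqrt (real n ^ 2 - 5 * real n + 8)"
  define r1 where "r1 = real n - 1 + s"
  define r2 where "r2 = real n - 1 - s"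
  have "real n ^ 2 - 5 * real n + 8 = (real n - 3) ^ 2 + (real n - 3) + 2"
    by (simp add: power2_eq_square algebra_simps)
  also have "\<dots> > 0" using n by (intro add_nonneg_pos add_nonneg_nonneg) auto
  finally have pos: "real n ^ 2 - 5 * real n + 8 > 0" .
  have s: "s > 0" "s ^ 2 = real n ^ 2 - 5 * real n + 8" using pos by (auto simp: s_def)
  \<comment> \<open>The gap is 3n - 7, positive for n \<ge> 3; this makes the smaller root
    \<open>r2\<close> positive.\<close>
  have "s ^ 2 < (real n - 1) ^ 2" unfolding s(2) using n by (simp add: power2_eq_square algebra_simps)
  hence "s < real n - 1" using n by (intro power_less_imp_less_base[of s 2]) auto
  hence r: "r2 > 0" "r1 > 0" "r1 \<noteq> r2" using s n by (auto simp: r1_def r2_def)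
  have sum_r: "r1 + r2 = 2 * real n - 2" by (simp add: r1_def r2_def)
  have prod_r: "r1 * r2 = 3 * real n - 7"
    using s(2) by (simp add: r1_def r2_def power2_eq_square algebra_simps)
  have quad: "[:3 * real n - 7, - (2 * real n - 2), 1:] = [:- r1, 1:] * [:- r2, 1:]"
    using sum_r prod_r by (simp add: algebra_simps)
  let ?p = "char_poly (star_matrix n k)"
  have cp: "?p = [:2, 1:] ^ (n - 2) * ([:- r1, 1:] * [:- r2, 1:])"
    using char_poly_star_matrix[OF k] n quad by simp
  have carr: "star_matrix n k \<in> carrier_mat n n" by (simp add: star_matrix_def)
  have "spectrum (star_matrix n k) = {x. poly ?p x = 0}"
    by (auto simp: spectrum_def eigenvalue_root_char_poly[OF carr])
  \<comment> \<open>Since n \<ge> 3, the exponent n - 2 is positive and -2 really is a root.\<close>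
  also have "\<dots> = {-2, r1, r2}"
    unfolding cp poly_mult poly_power using n by auto
  finally have spec: "spectrum (star_matrix n k) = {-2, r1, r2}" .
  have ord: "order x ?p = (if x = -2 then n - 2 else 0) + ((if x = r1 then 1 else 0)
      + (if x = r2 then 1 else 0))" for x
  proof -
    have nz: "[:- r1, 1:] * [:- r2, 1:] \<noteq> 0" "[:2, 1:] ^ (n - 2) * ([:- r1, 1:] * [:- r2, 1:]) \<noteq> 0"
      by (simp_all only: mult_eq_0_iff power_eq_0_iff pCons_eq_0_iff) simp_all
    show ?thesis
      unfolding cp order_mult[OF nz(2)] order_mult[OF nz(1)] order_linear_power
      using order_linear_power[of x "- r1" 1] order_linear_power[of x "- r2" 1] by auto
  qed
  show ?thesis
    unfolding spec ord using r sum_r n by (auto simp: algebra_simps of_nat_diff)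
qed

text \<open>With unit weights the cost of a walk is its length, so the infimum \<open>\<mu>\<close>
  is attained at \<open>p\<close>. It is finite, hence the conversion to a real loses
  nothing.\<close>

lemma graph_dist_eqI:
  assumes "wf_digraph G" and "pre_digraph.awalk G u p v"
    and min: "\<And>q. pre_digraph.awalk G u q v \<Longrightarrow> length p \<le> length q"
  shows "graph_dist G u v = length p"
proof -
  interpret wf_digraph G by fact
  have cost: "awalk_cost (\<lambda>_. 1) q = length q" for q
    by (simp add: awalk_cost_def sum_list_triv)
  have "\<mu> (\<lambda>_. 1) u v = ereal (length p)"
    unfolding \<mu>_def cost using assms(2) min
    by (intro antisym INF_greatest) (auto intro: INF_lower2)
  thus ?thesis by (simp add: graph_dist_def)
qed

lemma graph_dist_adjacent:
  assumes "wf_digraph G" "u \<noteq> v" "u \<rightarrow>\<^bsub>G\<^esub> v"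
  shows "graph_dist G u v = 1"
proof -
  interpret wf_digraph G by fact
  obtain e where e: "arc e (u, v)" using assms(3) by (auto simp: arcs_ends_def arc_def arc_to_ends_def)
  have "graph_dist G u v = length [e]"
  proof (rule graph_dist_eqI[OF assms(1)])
    show "awalk u [e] v" using e by (auto simp: arc_def awalk_Cons_iff awalk_Nil_iff)
    show "length [e] \<le> length q" if "awalk u q v" for q
      using that assms(2) by (cases q) (auto simp: awalk_Nil_iff)
  qed
  thus ?thesis by simp
qed

lemma graph_dist_common_neighbour:
  assumes "wf_digraph G" "u \<noteq> v" "\<not> u \<rightarrow>\<^bsub>G\<^esub> v" "u \<rightarrow>\<^bsub>G\<^esub> w" "w \<rightarrow>\<^bsub>G\<^esub> v"
  shows "graph_dist G u v = 2"
proof -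
  interpret wf_digraph G by fact
  obtain d e where e: "arc d (u, w)" "arc e (w, v)"
    using assms(4,5) by (auto simp: arcs_ends_def arc_def arc_to_ends_def)
  have "graph_dist G u v = length [d, e]"
  proof (rule graph_dist_eqI[OF assms(1)])
    show "awalk u [d, e] v" using e by (auto simp: arc_def awalk_Cons_iff awalk_Nil_iff)
    show "length [d, e] \<le> length q" if q: "awalk u q v" for q
    proof (rule ccontr)
      assume "\<not> length [d, e] \<le> length q"
      \<comment> \<open>An empty walk would force u = v, a single arc would make u and v
        adjacent.\<close>
      then consider "q = []" | a where "q = [a]" by (cases q; cases "tl q") auto
      thus False
      proof cases
        case 1
        thus False using q assms(2) by (simp add: awalk_Nil_iff)
      next
        case (2 a)
        hence "a \<in> arcs G" "tail G a = u" "head G a = v"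
          using q by (auto simp: awalk_Cons_iff awalk_Nil_iff)
        hence "u \<rightarrow>\<^bsub>G\<^esub> v" by (auto intro: in_arcs_imp_in_arcs_ends)
        thus False using assms(3) by simp
      qed
    qed
  qed
  thus ?thesis by simp
qed

text \<open>The value 2 at the centre alone bounds the weight by 2. Otherwise no leaf could have
  value 0, since its only neighbour is the centre, and the leaves would already use up the whole
  weight. With a single leaf the constant function 1 would also be minimal.\<close>

lemma gamma_R_function_star:
  assumes verts: "verts G = insert c L" "c \<notin> L" "finite L" "2 \<le> card L"
    and arcs: "arcs_ends G = {c} \<times> L \<union> L \<times> {c}"
    and f: "gamma_R_function G f"
  shows "f c = 2" and "\<forall>v\<in>L. f v = 0"
proof -
  define g where "g = (\<lambda>v. if v = c then 2 else 0 :: nat)"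
  have "roman_dominating G g" using verts by (auto simp: roman_dominating_def g_def arcs)
  moreover have "roman_weight G g = 2"
    using verts by (auto simp: roman_weight_def g_def intro!: sum.neutral)
  ultimately have "roman_domination_number G \<le> 2"
    unfolding roman_domination_number_def by (intro Least_le) auto
  hence rd: "roman_dominating G f" and w: "f c + sum f L \<le> 2"
    using f verts by (auto simp: gamma_R_function_def roman_weight_def)
  show c: "f c = 2"
  proof (rule ccontr)
    assume nc: "f c \<noteq> 2"
    have ge: "f l \<ge> 1" if "l \<in> L" for l
    proof (rule ccontr)
      assume "\<not> f l \<ge> 1"
      with that rd verts obtain v where "l \<rightarrow>\<^bsub>G\<^esub> v" "f v = 2" by (force simp: roman_dominating_def)
      with that verts nc show False by (auto simp: arcs)
    qed
    hence card_le: "card L \<le> sum f L" using sum_mono[of L "\<lambda>_. 1" f] by simp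
    with w verts have "f c = 0" by simp
    with rd verts obtain v where v: "c \<rightarrow>\<^bsub>G\<^esub> v" "f v = 2" by (force simp: roman_dominating_def)
    hence "v \<in> L" using verts by (auto simp: arcs)
    \<comment> \<open>The centre, having value 0, needs a leaf of value 2. As all leaves have value
      at least 1, their sum then exceeds \<open>card L\<close>, hence 2.\<close>
    hence "\<exists>a\<in>L. 1 < f a" using v(2) by (intro bexI[of _ v]) auto
    hence "card L < sum f L" using sum_strict_mono_ex1[of L "\<lambda>_. 1" f] ge verts by simp
    with w verts show False by simp
  qed
  with w verts show "\<forall>v\<in>L. f v = 0" by simp
qed

theorem theorem3p4:
  fixes n :: nat and G :: "('a, 'b) pre_digraph" and f :: "'a \<Rightarrow> nat" and vs :: "'a list"
  assumes "n \<ge> 3"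
    and "complete_bipartite_digraph 1 (n - 1) G"
    and "distinct vs" and "set vs = verts G"
    and "gamma_R_function G f"
  shows "roman_distance_energy G f vs = 4 * real n - 6"
proof -
  from assms(2) obtain U L where G: "graph G" and "verts G = U \<union> L" "U \<inter> L = {}" "card U = 1"
    and cardL: "card L = n - 1" and "arcs_ends G = U \<times> L \<union> L \<times> U"
    by (auto simp: complete_bipartite_digraph_def)
  then obtain c where verts: "verts G = insert c L" "c \<notin> L"
    and arcs: "arcs_ends G = {c} \<times> L \<union> L \<times> {c}"
    by (auto simp: card_1_singleton_iff)
  interpret graph G by fact
  have fin: "finite L" using finite_verts verts by simp
  have fc: "f c = 2" and fL: "\<forall>v\<in>L. f v = 0"
    using gamma_R_function_star[OF verts fin _ arcs assms(5)] cardL assms(1) by auto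
  have len: "length vs = n"
    using distinct_card[OF assms(3)] assms(1,4) verts fin cardL by simp
  \<comment> \<open>The centre may stand anywhere in \<open>vs\<close>; its position
    \<open>k\<close> does not affect the final sum.\<close>
  obtain k where k: "k < n" "vs ! k = c"
    using assms(4) verts(1) len by (metis in_set_conv_nth insertI1)
  have idx: "vs ! i = c \<longleftrightarrow> i = k" if "i < n" for i
    using that k len assms(3) by (metis nth_eq_iff_index_eq)
  have leaf: "vs ! i \<in> L" if "i < n" "i \<noteq> k" for i
    using that idx[of i] assms(4) verts len by (metis insertE nth_mem)
  \<comment> \<open>The centre is adjacent to every leaf, and two leaves are joined only through
    it.\<close>
  have dist: "graph_dist G (vs ! i) (vs ! j) = (if i = k \<or> j = k then 1 else 2)"
    if ij: "i < n" "j < n" "i \<noteq> j" for i j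
  proof -
    have ne: "vs ! i \<noteq> vs ! j" using ij assms(3) len by (simp add: nth_eq_iff_index_eq)
    show ?thesis
    proof (cases "i = k \<or> j = k")
      case True
      hence "vs ! i \<rightarrow>\<^bsub>G\<^esub> vs ! j" using ij k leaf by (auto simp: arcs)
      thus ?thesis using True ne by (simp add: graph_dist_adjacent[OF wf_digraph])
    next
      case False
      hence "vs ! i \<in> L" "vs ! j \<in> L" using ij leaf by auto
      hence "\<not> vs ! i \<rightarrow>\<^bsub>G\<^esub> vs ! j" "vs ! i \<rightarrow>\<^bsub>G\<^esub> c" "c \<rightarrow>\<^bsub>G\<^esub> vs ! j"
        using verts by (auto simp: arcs)
      thus ?thesis using False graph_dist_common_neighbour[OF wf_digraph ne] by simp
    qed
  qed
  have "roman_distance_matrix G f vs = star_matrix n k"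
    by (rule eq_matI)
       (use k fc fL leaf verts in \<open>auto simp: roman_distance_matrix_def star_matrix_def len dist
         level_set_def\<close>)
  thus ?thesis
    using sum_spectrum_star_matrix[OF k(1) assms(1)] by (simp add: roman_distance_energy_def Let_def)
qed

end
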